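(* For every integer $k\ge1$, let $\mathcal{C}=\mathrm{Av}(k\cdots1)$ be the class of permutations avoiding the decreasing permutation $k(k-1)\cdots1$. Then $\lim_{n\to\infty}|\mathcal{C}^{rc}_{2n}|^{1/n}$ exists and equals $\lim_{n\to\infty}|\mathcal{C}_n|^{1/n}$.
   Context: A permutation of size $n$ is a bijection of $[n]$; $\pi$ contains $\sigma$ if some subsequence of $\pi$ has the same relative order as $\sigma$, and avoids it otherwise; $\mathcal{C}_n$ is the set of size-$n$ elements of $\mathcal{C}$. For $\pi$ of size $n$, $\mathrm{rc}(\pi)(i)=n+1-\pi(n+1-i)$; $\pi$ is centrosymmetric if $\mathrm{rc}(\pi)=\pi$; $\mathcal{C}^{rc}_n$ is the set of centrosymmetric elements of $\mathcal{C}_n$. *)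

theory Defs
  imports Complex_Main "HOL-Combinatorics.Permutations"
begin

text \<open>A permutation of size \<open>n\<close> is a function with \<open>\<pi> permutes {1..n}\<close>; it is the identity outside
  \<open>{1..n}\<close>, so the size is not determined by the function and is passed explicitly. Accordingly a
  class of permutations is given by its family of size-\<open>n\<close> slices.\<close>

definition contains_pattern :: "nat \<Rightarrow> (nat \<Rightarrow> nat) \<Rightarrow> nat \<Rightarrow> (nat \<Rightarrow> nat) \<Rightarrow> bool" where
  "contains_pattern n \<pi> m \<sigma> \<longleftrightarrow>
     (\<exists>f. strict_mono_on {1..m} f \<and> f ` {1..m} \<subseteq> {1..n} \<and>
          (\<forall>i\<in>{1..m}. \<forall>j\<in>{1..m}. \<pi> (f i) < \<pi> (f j) \<longleftrightarrow> \<sigma> i < \<sigma> j))"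

definition Av :: "nat \<Rightarrow> (nat \<Rightarrow> nat) \<Rightarrow> nat \<Rightarrow> (nat \<Rightarrow> nat) set" where
  "Av m \<sigma> n = {\<pi>. \<pi> permutes {1..n} \<and> \<not> contains_pattern n \<pi> m \<sigma>}"

definition decreasing_perm :: "nat \<Rightarrow> nat \<Rightarrow> nat" where
  "decreasing_perm k i = (if i \<in> {1..k} then k + 1 - i else i)"

definition rc :: "nat \<Rightarrow> (nat \<Rightarrow> nat) \<Rightarrow> nat \<Rightarrow> nat" where
  "rc n \<pi> i = (if i \<in> {1..n} then n + 1 - \<pi> (n + 1 - i) else i)"

definition centrosymmetric :: "nat \<Rightarrow> (nat \<Rightarrow> nat) \<Rightarrow> bool" where
  "centrosymmetric n \<pi> \<longleftrightarrow> rc n \<pi> = \<pi>"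

definition rc_slice :: "(nat \<Rightarrow> (nat \<Rightarrow> nat) set) \<Rightarrow> nat \<Rightarrow> (nat \<Rightarrow> nat) set" where
  "rc_slice C n = {\<pi> \<in> C n. centrosymmetric n \<pi>}"

lemma decreasing_perm_permutes: "decreasing_perm k permutes {1..k}"
proof (rule bij_imp_permutes)
  show "bij_betw (decreasing_perm k) {1..k} {1..k}"
    by (rule bij_betw_byWitness[where f' = "decreasing_perm k"]) (auto simp: decreasing_perm_def)
qed (auto simp: decreasing_perm_def)

end

theory Submission
  imports Defs "HOL-Library.Infinite_Set" "HOL-Real_Asymp.Real_Asymp"
begin

text \<open>
  Write \<open>d = k - 1\<close>; both limits are \<open>d\<^sup>2\<close>. The direct sum of \<open>\<pi>\<close> and its reverse complement
  embeds the size-\<open>n\<close> members of the class into the centrosymmetric members of size \<open>2 n\<close>.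

  Upper bound: a centrosymmetric permutation without decreasing subsequence of length \<open>d + 1\<close> is a
  union of \<open>d\<close> increasing sequences that can be chosen so that the half turn reverses the order of the
  colours. Such a permutation is determined by the colours of its first \<open>n\<close> positions and of its
  first \<open>n\<close> values, so there are at most \<open>d\<close> to the power \<open>2 n\<close> of them.

  Lower bound: a pair of ballot words in which each of \<open>d\<close> letters occurs \<open>m\<close> times gives a
  permutation of size \<open>d m\<close> in the class, and the pair can be recovered from it. To obtain
  many ballot words, put arbitrary balanced blocks, in which each letter occurs \<open>B\<close> times, between
  a prefix that gives each letter a lead of \<open>B\<close> over the next one and a suffix that evens the
  counts out. The number of balanced blocks is \<open>d\<close> to the power \<open>d B\<close>, up to a factor
  polynomial in \<open>B\<close>.
\<close>

subsection \<open>Decreasing subsequences and doubling\<close>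

text \<open>Decreasing subsequences are handled as sets of positions, so that gluing, reflecting and
  counting them become operations on sets.\<close>

definition dec_set :: "(nat \<Rightarrow> nat) \<Rightarrow> nat set \<Rightarrow> bool" where
  "dec_set \<pi> S \<longleftrightarrow> (\<forall>x\<in>S. \<forall>y\<in>S. x < y \<longrightarrow> \<pi> y < \<pi> x)"

lemma dec_setD: "dec_set \<pi> S \<Longrightarrow> x \<in> S \<Longrightarrow> y \<in> S \<Longrightarrow> x < y \<Longrightarrow> \<pi> y < \<pi> x"
  by (auto simp: dec_set_def)

text \<open>The image of an occurrence is a decreasing set of size \<open>k\<close>; conversely, the
  increasing enumeration of such a set is an occurrence.\<close>

lemma contains_decreasing_iff:
  "contains_pattern n \<pi> k (decreasing_perm k) \<longleftrightarrow> (\<exists>S\<subseteq>{1..n}. card S = k \<and> dec_set \<pi> S)"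
proof
  assume "contains_pattern n \<pi> k (decreasing_perm k)"
  then obtain f where f: "strict_mono_on {1..k} f" "f ` {1..k} \<subseteq> {1..n}"
    and ord: "\<And>i j. i \<in> {1..k} \<Longrightarrow> j \<in> {1..k} \<Longrightarrow>
      \<pi> (f i) < \<pi> (f j) \<longleftrightarrow> decreasing_perm k i < decreasing_perm k j"
    unfolding contains_pattern_def by blast
  have "card (f ` {1..k}) = k"
    using f(1) by (simp add: card_image strict_mono_on_imp_inj_on)
  moreover have "dec_set \<pi> (f ` {1..k})"
    unfolding dec_set_def
  proof safe
    fix i j assume ij: "i \<in> {1..k}" "j \<in> {1..k}" "f i < f j"
    then have "i < j"
      using strict_mono_on_less[OF f(1)] by blast
    then show "\<pi> (f j) < \<pi> (f i)"
      using ord[of j i] ij by (simp add: decreasing_perm_def)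
  qed
  ultimately show "\<exists>S\<subseteq>{1..n}. card S = k \<and> dec_set \<pi> S"
    using f(2) by blast
next
  assume "\<exists>S\<subseteq>{1..n}. card S = k \<and> dec_set \<pi> S"
  then obtain S where S: "S \<subseteq> {1..n}" "card S = k" "dec_set \<pi> S"
    by blast
  then have "finite S"
    using finite_subset by blast
  then obtain h where h: "bij_betw h {..<k} S" "strict_mono_on {..<k} h"
    using ex_bij_betw_strict_mono_card[of S] S(2) by metis
  \<comment> \<open>The enumeration \<open>h\<close> counts from 0, pattern positions count from
    1.\<close>
  define f where "f i = h (i - 1)" for i
  have mem: "f i \<in> S" if "i \<in> {1..k}" for i
    using that h(1) by (force simp: f_def bij_betw_def)
  have less: "f i < f j" if "i \<in> {1..k}" "j \<in> {1..k}" "i < j" for i j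
    using that strict_mono_onD[OF h(2), of "i - 1" "j - 1"] by (auto simp: f_def)
  have "\<pi> (f i) < \<pi> (f j) \<longleftrightarrow> decreasing_perm k i < decreasing_perm k j"
    if "i \<in> {1..k}" "j \<in> {1..k}" for i j
    using that less[of i j] less[of j i] dec_setD[OF S(3) mem mem, of i j]
      dec_setD[OF S(3) mem mem, of j i]
    by (cases i j rule: linorder_cases) (auto simp: decreasing_perm_def)
  then show "contains_pattern n \<pi> k (decreasing_perm k)"
    unfolding contains_pattern_def using less mem S(1)
    by (intro exI[of _ f]) (auto simp: strict_mono_on_def)
qed

text \<open>Subsets of decreasing sets are decreasing, so one with more than \<open>d\<close>
  elements contains one with exactly \<open>d + 1\<close>.\<close>

lemma Av_decreasing_iff:
  "\<pi> \<in> Av (Suc d) (decreasing_perm (Suc d)) n \<longleftrightarrow>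
     \<pi> permutes {1..n} \<and> (\<forall>S\<subseteq>{1..n}. dec_set \<pi> S \<longrightarrow> card S \<le> d)"
proof -
  have "(\<exists>S\<subseteq>{1..n}. card S = Suc d \<and> dec_set \<pi> S) \<longleftrightarrow>
      (\<exists>S\<subseteq>{1..n}. dec_set \<pi> S \<and> d < card S)"
  proof safe
    fix S assume S: "S \<subseteq> {1..n}" "dec_set \<pi> S" "d < card S"
    then obtain U where "U \<subseteq> S" "card U = Suc d"
      by (meson Suc_leI obtain_subset_with_card_n)
    then show "\<exists>S\<subseteq>{1..n}. card S = Suc d \<and> dec_set \<pi> S"
      using S by (intro exI[of _ U]) (auto simp: dec_set_def)
  qed auto
  then show ?thesis
    by (auto simp: Av_def contains_decreasing_iff not_less)
qed

lemma finite_Av: "finite (Av m \<sigma> n)"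
  by (rule finite_subset[OF _ finite_permutations[of "{1..n}"]]) (auto simp: Av_def)

lemma finite_rc_slice: "finite (rc_slice (Av m \<sigma>) n)"
  by (rule finite_subset[OF _ finite_Av]) (auto simp: rc_slice_def)

text \<open>Reversing positions and complementing values each turn the order around, so a half turn
  preserves decrease. The bound by \<open>M\<close> keeps truncated subtraction strictly
  order-reversing on the values concerned.\<close>

lemma dec_set_reflect:
  assumes "dec_set \<pi> S" "S \<subseteq> {1..N}"
    and refl: "\<And>p. p \<in> S \<Longrightarrow> \<sigma> (N + 1 - p) = M - \<pi> p" and le: "\<And>p. p \<in> S \<Longrightarrow> \<pi> p \<le> M"
  shows "dec_set \<sigma> ((\<lambda>p. N + 1 - p) ` S)"
  unfolding dec_set_def
proof safe
  fix x y assume xy: "x \<in> S" "y \<in> S" "N + 1 - x < N + 1 - y"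
  then have "y < x"
    by auto
  then have "\<pi> x < \<pi> y"
    using assms(1) xy by (auto simp: dec_set_def)
  then show "\<sigma> (N + 1 - y) < \<sigma> (N + 1 - x)"
    using refl le[of x] le[of y] xy by simp
qed

lemma card_reflect:
  assumes "S \<subseteq> {1..N::nat}"
  shows "card ((\<lambda>p. N + 1 - p) ` S) = card S"
  using assms by (intro card_image inj_onI) (force simp: subset_iff)

text \<open>The new point \<open>n + 1\<close> is a fixed maximum at the right end, so the only
  decreasing set containing it is a singleton, which is small enough because
  \<open>1 \<le> d\<close>. This later carries lower bounds from special sizes to all sizes.\<close>

lemma Av_decreasing_mono:
  assumes "1 \<le> d"
  shows "Av (Suc d) (decreasing_perm (Suc d)) n \<subseteq> Av (Suc d) (decreasing_perm (Suc d)) (Suc n)"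
proof
  fix \<pi> assume "\<pi> \<in> Av (Suc d) (decreasing_perm (Suc d)) n"
  then have perm: "\<pi> permutes {1..n}" and av: "\<And>S. S \<subseteq> {1..n} \<Longrightarrow> dec_set \<pi> S \<Longrightarrow> card S \<le> d"
    by (auto simp: Av_decreasing_iff)
  have "card S \<le> d" if S: "S \<subseteq> {1..Suc n}" "dec_set \<pi> S" for S
  proof (cases "Suc n \<in> S")
    case True
    have "x = Suc n" if x: "x \<in> S" for x
    proof (rule ccontr)
      assume "x \<noteq> Suc n"
      then have "x \<in> {1..n}"
        using x S(1) by force
      then have "\<pi> x \<le> n" "\<pi> (Suc n) = Suc n" "\<pi> (Suc n) < \<pi> x"
        using permutes_in_image[OF perm, of x] permutes_not_in[OF perm, of "Suc n"]
          dec_setD[OF S(2) x True] by auto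
      then show False
        by simp
    qed
    then have "S = {Suc n}"
      using True by blast
    then show ?thesis
      using assms by simp
  next
    case False
    then have "S \<subseteq> {1..n}"
      using S(1) by (force simp: le_Suc_eq)
    then show ?thesis
      using av S(2) by blast
  qed
  moreover have "\<pi> permutes {1..Suc n}"
    using perm by (rule permutes_subset) auto
  ultimately show "\<pi> \<in> Av (Suc d) (decreasing_perm (Suc d)) (Suc n)"
    by (auto simp: Av_decreasing_iff)
qed

section \<open>The direct sum of a permutation and its reverse complement\<close>

lemma diff_left_cancel_nat:
  fixes a b c :: nat
  assumes "c - a = c - b" "a \<le> c" "b \<le> c"
  shows "a = b"
  using assms by linarith

text \<open>The right half is the half turn of the left one. Beyond \<open>2 * n\<close> the value
  falls back on \<open>\<pi>\<close>, which is the identity there if it permutes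
  \<open>{1..n}\<close>.\<close>

definition sym_double :: "nat \<Rightarrow> (nat \<Rightarrow> nat) \<Rightarrow> nat \<Rightarrow> nat" where
  "sym_double n \<pi> p =
     (if p \<in> {n+1..2*n} then 2 * n + 1 - \<pi> (2 * n + 1 - p) else \<pi> p)"

text \<open>All values on the left half of the positions lie below all values on the right half.
  Hence a decreasing set stays in one half, and one in the right half can be turned into the left
  half, where \<open>\<pi>\<close> bounds its size.\<close>

lemma sym_double_in_rc_slice:
  assumes "\<pi> \<in> Av (Suc d) (decreasing_perm (Suc d)) n"
  shows "sym_double n \<pi> \<in> rc_slice (Av (Suc d) (decreasing_perm (Suc d))) (2 * n)"
proof -
  let ?\<sigma> = "sym_double n \<pi>"
  have perm: "\<pi> permutes {1..n}" and av: "\<And>S. S \<subseteq> {1..n} \<Longrightarrow> dec_set \<pi> S \<Longrightarrow> card S \<le> d"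
    using assms by (auto simp: Av_decreasing_iff)
  have rng: "1 \<le> \<pi> p \<and> \<pi> p \<le> n" if "1 \<le> p" "p \<le> n" for p
    using permutes_in_image[OF perm, of p] that by simp
  have rng': "1 \<le> \<pi> (2 * n + 1 - p) \<and> \<pi> (2 * n + 1 - p) \<le> n" if "n < p" "p \<le> 2 * n" for p
    using that by (intro rng) auto
  have out: "\<pi> p = p" if "\<not> (1 \<le> p \<and> p \<le> n)" for p
    using permutes_not_in[OF perm, of p] that by auto
  have left: "?\<sigma> p = \<pi> p" if "p \<le> n" for p
    using that by (simp add: sym_double_def)
  have right: "?\<sigma> (2 * n + 1 - p) = 2 * n + 1 - \<pi> p" if "1 \<le> p" "p \<le> n" for p
  proof -
    have "2 * n + 1 - p \<in> {n+1..2*n}" "2 * n + 1 - (2 * n + 1 - p) = p"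
      using that by auto
    then show ?thesis
      by (simp only: sym_double_def if_True)
  qed
  have refl: "?\<sigma> (2 * n + 1 - p) = 2 * n + 1 - ?\<sigma> p" if "1 \<le> p" "p \<le> 2 * n" for p
  proof (cases "p \<le> n")
    case True
    then show ?thesis using left right that by simp
  next
    case False
    then have q: "1 \<le> 2*n+1-p" "2*n+1-p \<le> n" "2*n+1-(2*n+1-p) = p"
      using that by auto
    show ?thesis
      using left[OF q(2)] right[OF q(1,2)] rng[OF q(1,2)] q(3) by simp
  qed
  have inj: "inj_on ?\<sigma> {1..2*n}"
  proof -
    have low: "?\<sigma> p \<le> n \<longleftrightarrow> p \<le> n" if "p \<in> {1..2*n}" for p
      using that rng[of p] rng'[of p] by (auto simp: sym_double_def)
    have "p = q" if pq: "p \<in> {1..2*n}" "q \<in> {1..2*n}" "?\<sigma> p = ?\<sigma> q" for p q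
    proof (cases "p \<le> n")
      case True
      then have "\<pi> p = \<pi> q" using low[OF pq(1)] low[OF pq(2)] left pq(3) by simp
      then show ?thesis using permutes_inj[OF perm] by (simp add: inj_eq)
    next
      case False
      then have nq: "\<not> q \<le> n" using low[OF pq(1)] low[OF pq(2)] pq(3) by simp
      have "\<pi> (2*n+1-p) = \<pi> (2*n+1-q)"
      proof -
        have "2*n+1 - \<pi> (2*n+1-p) = 2*n+1 - \<pi> (2*n+1-q)"
          using pq False nq unfolding sym_double_def by (simp only: atLeastAtMost_iff) simp
        moreover have "\<pi> (2*n+1-p) \<le> 2*n+1"
          using rng'[of p] pq(1) False by simp
        moreover have "\<pi> (2*n+1-q) \<le> 2*n+1"
          using rng'[of q] pq(2) nq by simp
        ultimately show ?thesis
          by (rule diff_left_cancel_nat)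
      qed
      then have "2*n+1-p = 2*n+1-q" using permutes_inj[OF perm] by (simp add: inj_eq)
      then show ?thesis using pq by auto
    qed
    then show ?thesis by (auto intro: inj_onI)
  qed
  have into: "?\<sigma> ` {1..2*n} \<subseteq> {1..2*n}"
  proof safe
    fix p assume "p \<in> {1..2*n}"
    then show "?\<sigma> p \<in> {1..2*n}"
      using rng[of p] rng'[of p] by (auto simp: sym_double_def)
  qed
  have "?\<sigma> permutes {1..2*n}"
  proof (rule bij_imp_permutes)
    show "bij_betw ?\<sigma> {1..2*n} {1..2*n}"
      using inj into endo_inj_surj[of "{1..2*n}" ?\<sigma>] by (auto simp: bij_betw_def)
    show "?\<sigma> p = p" if "p \<notin> {1..2*n}" for p
      using that out[of p] by (auto simp: sym_double_def)
  qed
  moreover have "card S \<le> d" if S: "S \<subseteq> {1..2*n}" "dec_set ?\<sigma> S" for S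
  proof (cases "\<exists>p\<in>S. p \<le> n")
    case True
    then obtain p where p: "p \<in> S" "p \<le> n" by blast
    have "q \<le> n" if q: "q \<in> S" for q
    proof (rule ccontr)
      assume nq: "\<not> q \<le> n"
      have "?\<sigma> q < ?\<sigma> p"
        using S p q nq by (auto intro: dec_setD)
      then show False
        using p S(1) q nq rng[of p] rng'[of q]
        by (force simp: sym_double_def subset_iff)
    qed
    then have "S \<subseteq> {1..n}" using S(1) by auto
    moreover have "dec_set \<pi> S" using S(2) \<open>S \<subseteq> {1..n}\<close> left by (auto simp: dec_set_def subset_iff)
    ultimately show ?thesis using av by blast
  next
    case False
    let ?R = "(\<lambda>p. 2 * n + 1 - p) ` S"
    have "?R \<subseteq> {1..n}" using False S(1) by (force simp: subset_iff)
    moreover have "dec_set ?\<sigma> ?R"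
    proof (rule dec_set_reflect[OF S(2,1)])
      show "?\<sigma> (2 * n + 1 - p) = 2 * n + 1 - ?\<sigma> p" if "p \<in> S" for p
        using that S(1) refl[of p] by (auto simp: subset_iff)
      show "?\<sigma> p \<le> 2 * n + 1" if "p \<in> S" for p
      proof -
        have "?\<sigma> p \<in> {1..2*n}"
          using that S(1) into by blast
        then show ?thesis
          by simp
      qed
    qed
    then have "dec_set \<pi> ?R" using \<open>?R \<subseteq> {1..n}\<close> left by (simp add: dec_set_def subset_iff)
    ultimately show ?thesis using av card_reflect[OF S(1)] by metis
  qed
  moreover have "rc (2*n) ?\<sigma> = ?\<sigma>"
  proof
    fix p
    show "rc (2*n) ?\<sigma> p = ?\<sigma> p"
    proof (cases "p \<in> {1..2*n}")
      case True
      then have "?\<sigma> p \<in> {1..2*n}"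
        using into by blast
      then show ?thesis using True refl[of p] by (simp add: rc_def)
    next
      case False
      then show ?thesis using out[of p] by (auto simp: rc_def sym_double_def)
    qed
  qed
  ultimately show ?thesis
    by (auto simp: rc_slice_def centrosymmetric_def Av_decreasing_iff)
qed

lemma card_Av_le_card_rc_slice:
  "card (Av (Suc d) (decreasing_perm (Suc d)) n)
     \<le> card (rc_slice (Av (Suc d) (decreasing_perm (Suc d))) (2 * n))"
proof (rule card_inj_on_le[where f = "sym_double n"])
  show "inj_on (sym_double n) (Av (Suc d) (decreasing_perm (Suc d)) n)"
  proof (rule inj_onI)
    fix \<pi> \<tau> assume mem: "\<pi> \<in> Av (Suc d) (decreasing_perm (Suc d)) n"
      "\<tau> \<in> Av (Suc d) (decreasing_perm (Suc d)) n" and eq: "sym_double n \<pi> = sym_double n \<tau>"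
    show "\<pi> = \<tau>"
    proof
      fix p
      show "\<pi> p = \<tau> p"
      proof (cases "p \<in> {1..n}")
        case True
        then show ?thesis
          using fun_cong[OF eq, of p] by (simp add: sym_double_def)
      next
        case False
        then show ?thesis
          using mem permutes_not_in unfolding Av_def by (metis (mono_tags, lifting) mem_Collect_eq)
      qed
    qed
  qed
  show "sym_double n ` Av (Suc d) (decreasing_perm (Suc d)) n
      \<subseteq> rc_slice (Av (Suc d) (decreasing_perm (Suc d))) (2 * n)"
    using sym_double_in_rc_slice by blast
qed (rule finite_rc_slice)

subsection \<open>Upper bound by antisymmetric colourings\<close>

text \<open>The greedy colouring behind partitions of a permutation into increasing sequences. It is
  meaningful only for \<open>1 \<le> p\<close>, since for \<open>p = 0\<close> the maximum is over
  the empty set.\<close>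

definition dec_rank :: "(nat \<Rightarrow> nat) \<Rightarrow> nat \<Rightarrow> nat" where
  "dec_rank \<pi> p = Max (card ` {S. S \<subseteq> {1..p} \<and> p \<in> S \<and> dec_set \<pi> S})"

lemma dec_rank_ge:
  assumes "S \<subseteq> {1..p}" "p \<in> S" "dec_set \<pi> S"
  shows "card S \<le> dec_rank \<pi> p"
  unfolding dec_rank_def using assms by (intro Max_ge) auto

lemma dec_rank_witness:
  assumes "1 \<le> p"
  obtains S where "S \<subseteq> {1..p}" "p \<in> S" "dec_set \<pi> S" "card S = dec_rank \<pi> p"
proof -
  have "{p} \<in> {S. S \<subseteq> {1..p} \<and> p \<in> S \<and> dec_set \<pi> S}"
    using assms by (auto simp: dec_set_def)
  then have "dec_rank \<pi> p \<in> card ` {S. S \<subseteq> {1..p} \<and> p \<in> S \<and> dec_set \<pi> S}"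
    unfolding dec_rank_def by (intro Max_in) auto
  then show thesis
    using that by auto
qed

lemma dec_rank_pos: "1 \<le> p \<Longrightarrow> 1 \<le> dec_rank \<pi> p"
  using dec_rank_ge[of "{p}" p \<pi>] by (auto simp: dec_set_def)

text \<open>A longest decreasing set ending at \<open>p\<close> can be extended by
  \<open>q\<close>.\<close>

lemma dec_rank_less:
  assumes "1 \<le> p" "p < q" "\<pi> q < \<pi> p"
  shows "dec_rank \<pi> p < dec_rank \<pi> q"
proof -
  obtain S where S: "S \<subseteq> {1..p}" "p \<in> S" "dec_set \<pi> S" "card S = dec_rank \<pi> p"
    using dec_rank_witness assms(1) by blast
  have "\<pi> q < \<pi> x" if "x \<in> S" for x
    using that S assms(3) dec_setD[OF S(3) that S(2)] by (cases "x = p") force+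
  then have "dec_set \<pi> (insert q S)"
    using S assms(2) by (auto simp: dec_set_def subset_iff)
  then have "card (insert q S) \<le> dec_rank \<pi> q"
    using S(1) assms by (intro dec_rank_ge) auto
  moreover have "finite S" "q \<notin> S"
    using S(1) assms(2) finite_subset by auto
  ultimately show ?thesis
    using S(4) by simp
qed

text \<open>A longest decreasing set ending at \<open>N + 1 - p\<close> reflects to one starting at
  \<open>p\<close>. Glued to a longest one ending at \<open>p\<close> it forms a decreasing set, and
  only \<open>p\<close> is counted twice, whence \<open>d + 1\<close>.\<close>

lemma dec_rank_reflect_le:
  assumes perm: "\<pi> permutes {1..N}" and av: "\<And>S. S \<subseteq> {1..N} \<Longrightarrow> dec_set \<pi> S \<Longrightarrow> card S \<le> d"
    and refl: "\<And>p. p \<in> {1..N} \<Longrightarrow> \<pi> (N + 1 - p) = N + 1 - \<pi> p"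
    and p: "p \<in> {1..N}"
  shows "dec_rank \<pi> p + dec_rank \<pi> (N + 1 - p) \<le> d + 1"
proof -
  obtain S where S: "S \<subseteq> {1..p}" "p \<in> S" "dec_set \<pi> S" "card S = dec_rank \<pi> p"
    using dec_rank_witness p by (metis atLeastAtMost_iff)
  have "1 \<le> N + 1 - p"
    using p unfolding atLeastAtMost_iff by linarith
  then obtain U where U: "U \<subseteq> {1..N+1-p}" "N+1-p \<in> U" "dec_set \<pi> U" "card U = dec_rank \<pi> (N+1-p)"
    using dec_rank_witness by blast
  let ?R = "(\<lambda>p. N + 1 - p) ` U"
  have UN: "U \<subseteq> {1..N}"
    using U(1) p by force
  have R: "dec_set \<pi> ?R"
  proof (rule dec_set_reflect[OF U(3) UN])
    show "\<pi> (N + 1 - x) = N + 1 - \<pi> x" if "x \<in> U" for x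
      using refl UN that by blast
    show "\<pi> x \<le> N + 1" if "x \<in> U" for x
      using permutes_in_image[OF perm, of x] UN that by force
  qed
  have Rp: "?R \<subseteq> {p..N}" "p \<in> ?R"
    using U(1,2) UN p by (force simp: subset_iff image_iff)+
  have "dec_set \<pi> (S \<union> ?R)"
    unfolding dec_set_def
  proof (intro ballI impI)
    fix x y assume xy: "x \<in> S \<union> ?R" "y \<in> S \<union> ?R" "x < y"
    \<comment> \<open>As \<open>p\<close> belongs to both sets, a pair with \<open>x = p\<close> or
      \<open>y = p\<close> falls under one of the first two cases; in the third the comparison
      passes through \<open>p\<close>.\<close>
    consider "x \<in> S" "y \<in> S" | "x \<in> ?R" "y \<in> ?R" | "x \<in> S" "y \<in> ?R" "x < p" "p < y"
    proof -
      have a: "z \<le> p" if "z \<in> S" for z using that S(1) by auto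
      have b: "p \<le> z" if "z \<in> ?R" for z using that Rp(1) by auto
      show ?thesis
      proof (cases "x \<in> S"; cases "y \<in> S")
        assume "x \<notin> S" "y \<in> S"
        then show ?thesis using a[of y] b[of x] xy by auto
      next
        assume "x \<in> S" "y \<notin> S"
        then show ?thesis
          using that a[of x] b[of y] xy Rp(2) S(2) by (cases "x = p"; cases "y = p") auto
      qed (use that xy in blast)+
    qed
    then show "\<pi> y < \<pi> x"
    proof cases
      case 3
      then have "\<pi> y < \<pi> p" "\<pi> p < \<pi> x"
        using dec_setD[OF S(3) _ S(2)] dec_setD[OF R Rp(2)] by auto
      then show ?thesis by simp
    qed (use xy dec_setD[OF S(3)] dec_setD[OF R] in blast)+
  qed
  moreover have "S \<union> ?R \<subseteq> {1..N}"
    using S(1) Rp(1) p by force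
  ultimately have le: "card (S \<union> ?R) \<le> d"
    using av by blast
  have fin: "finite S" "finite ?R"
    using S(1) UN finite_subset by blast+
  have "S \<inter> ?R \<subseteq> {p}"
    using S(1) Rp(1) by force
  then have "card (S \<inter> ?R) \<le> 1"
    using card_mono[of "{p}" "S \<inter> ?R"] by simp
  moreover have "card S + card ?R = card (S \<union> ?R) + card (S \<inter> ?R)"
    using card_Un_Int[OF fin] .
  ultimately show ?thesis
    using le S(4) U(4) card_reflect[OF UN] by linarith
qed

text \<open>Rounding the average of \<open>dec_rank \<pi> p\<close> and \<open>d + 1 - dec_rank \<pi> (2 n + 1 - p)\<close> down on the
  left half and up on the right half makes the colouring antisymmetric under the half turn.\<close>

definition half_colour :: "nat \<Rightarrow> nat \<Rightarrow> (nat \<Rightarrow> nat) \<Rightarrow> nat \<Rightarrow> nat" where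
  "half_colour d n \<pi> p =
     (dec_rank \<pi> p + (d + 1) - dec_rank \<pi> (2 * n + 1 - p) + (if p \<le> n then 0 else 1)) div 2"

lemma half_colour_properties:
  assumes "\<pi> \<in> rc_slice (Av (Suc d) (decreasing_perm (Suc d))) (2 * n)"
  defines "c \<equiv> half_colour d n \<pi>"
  shows "\<pi> permutes {1..2*n}"
    and "p \<in> {1..2*n} \<Longrightarrow> \<pi> (2 * n + 1 - p) = 2 * n + 1 - \<pi> p"
    and "p \<in> {1..2*n} \<Longrightarrow> c p \<in> {1..d}"
    and "p \<in> {1..2*n} \<Longrightarrow> c (2 * n + 1 - p) = d + 1 - c p"
    and "p \<in> {1..2*n} \<Longrightarrow> q \<in> {1..2*n} \<Longrightarrow> p < q \<Longrightarrow> c p = c q \<Longrightarrow> \<pi> p < \<pi> q"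
proof -
  show perm: "\<pi> permutes {1..2*n}"
    using assms by (auto simp: rc_slice_def Av_def)
  have av: "\<And>S. S \<subseteq> {1..2*n} \<Longrightarrow> dec_set \<pi> S \<Longrightarrow> card S \<le> d"
    using assms by (auto simp: rc_slice_def Av_decreasing_iff)
  have rc: "rc (2*n) \<pi> = \<pi>"
    using assms by (auto simp: rc_slice_def centrosymmetric_def)
  have rng: "\<pi> p \<in> {1..2*n}" if "p \<in> {1..2*n}" for p
    using that permutes_in_image[OF perm] by blast
  show refl: "\<pi> (2 * n + 1 - p) = 2 * n + 1 - \<pi> p" if "p \<in> {1..2*n}" for p
  proof -
    have "\<pi> p = 2*n+1 - \<pi> (2*n+1-p)"
      using fun_cong[OF rc, of p] that by (simp add: rc_def)
    moreover have "\<pi> (2*n+1-p) \<in> {1..2*n}"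
      using that by (intro rng) auto
    ultimately show ?thesis
      by auto
  qed
  have bd: "dec_rank \<pi> p + dec_rank \<pi> (2 * n + 1 - p) \<le> d + 1" if "p \<in> {1..2*n}" for p
    using dec_rank_reflect_le[OF perm av refl that] .
  have pos: "1 \<le> dec_rank \<pi> p \<and> 1 \<le> dec_rank \<pi> (2*n+1-p)" if "p \<in> {1..2*n}" for p
    using that dec_rank_pos by auto
  \<comment> \<open>For ranks \<open>a\<close> and \<open>b\<close> of \<open>p\<close> and its
    reflection, both at least 1, the bound \<open>a + b \<le> d + 1\<close> puts the numerator
    between \<open>2 * a\<close> and \<open>2 * (d + 1 - b) + 1\<close>, rounding term
    included.\<close>
  show "c p \<in> {1..d}" if p: "p \<in> {1..2*n}"
    using bd[OF p] pos[OF p] by (auto simp: c_def half_colour_def)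
  show "c (2 * n + 1 - p) = d + 1 - c p" if p: "p \<in> {1..2*n}"
  proof -
    define x where "x = dec_rank \<pi> p + (d + 1) - dec_rank \<pi> (2 * n + 1 - p)"
    define y where "y = dec_rank \<pi> (2 * n + 1 - p) + (d + 1) - dec_rank \<pi> p"
    \<comment> \<open>An even sum means equal parity of \<open>x\<close> and \<open>y\<close>, so
      halving one rounded down and the other rounded up gives total \<open>d + 1\<close>.\<close>
    have "x + y = 2 * (d + 1)"
    proof -
      have "(a + s - b) + (b + s - a) = 2 * s" if "a + b \<le> s" for a b s :: nat
        using that by linarith
      then show ?thesis
        unfolding x_def y_def using bd[OF p] by blast
    qed
    moreover have "2 * n + 1 - (2 * n + 1 - p) = p" "2 * n + 1 - p \<le> n \<longleftrightarrow> \<not> p \<le> n"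
      using p by auto
    then have "c p = (x + (if p \<le> n then 0 else 1)) div 2"
      "c (2 * n + 1 - p) = (y + (if p \<le> n then 1 else 0)) div 2"
      by (simp_all add: c_def half_colour_def x_def y_def)
    ultimately show ?thesis
      by (cases "p \<le> n") (simp; presburger)+
  qed
  show "\<pi> p < \<pi> q" if pq: "p \<in> {1..2*n}" "q \<in> {1..2*n}" "p < q" "c p = c q"
  proof (rule ccontr)
    assume "\<not> \<pi> p < \<pi> q"
    then have gt: "\<pi> q < \<pi> p"
      using pq(3) injD[OF permutes_inj[OF perm], of p q] by (cases "\<pi> p" "\<pi> q" rule: linorder_cases) auto
    have "dec_rank \<pi> p < dec_rank \<pi> q"
      using gt pq by (intro dec_rank_less) auto
    \<comment> \<open>The half turn maps the inversion \<open>p < q\<close> to an inversion whose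
      left end is the reflection of \<open>q\<close>.\<close>
    moreover have "dec_rank \<pi> (2*n+1-q) < dec_rank \<pi> (2*n+1-p)"
    proof (rule dec_rank_less)
      show "\<pi> (2*n+1-p) < \<pi> (2*n+1-q)"
        using gt refl pq(1,2) rng by force
    qed (use pq in auto)
    \<comment> \<open>Each of the two rank changes raises the numerator by at least 1; together they
      raise it by 2, which survives the halving.\<close>
    moreover have "(a + s - b + e) div 2 < (a' + s - b' + e') div 2"
      if "a < a'" "b' < b" "a + b \<le> s" "e \<le> e'" for a a' b b' e e' s :: nat
    proof -
      have "a + s - b + e + 2 \<le> a' + s - b' + e'"
        using that by linarith
      then show ?thesis
        by linarith
    qed
    moreover have "(if p \<le> n then 0 else 1 :: nat) \<le> (if q \<le> n then 0 else 1)"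
      using pq(3) by simp
    ultimately have "c p < c q"
      unfolding c_def half_colour_def using bd[OF pq(1)] by blast
    then show False
      using pq(4) by simp
  qed
qed

text \<open>Within each colour the positions receive the values in increasing order, so nothing is
  left to choose. At a first disagreement, the smaller of the two values is taken by the other
  permutation at an earlier position of the same colour, where both agree; this contradicts
  injectivity.\<close>

lemma perm_eq_if_colours_eq:
  fixes \<pi> \<tau> c e :: "nat \<Rightarrow> nat"
  assumes perm: "\<pi> permutes S" "\<tau> permutes S"
    and e: "\<And>p. p \<in> S \<Longrightarrow> e (\<pi> p) = c p" "\<And>p. p \<in> S \<Longrightarrow> e (\<tau> p) = c p"
    and mono: "\<And>p q. p \<in> S \<Longrightarrow> q \<in> S \<Longrightarrow> p < q \<Longrightarrow> c p = c q \<Longrightarrow> \<pi> p < \<pi> q"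
      "\<And>p q. p \<in> S \<Longrightarrow> q \<in> S \<Longrightarrow> p < q \<Longrightarrow> c p = c q \<Longrightarrow> \<tau> p < \<tau> q"
  shows "\<pi> = \<tau>"
proof
  have step: False
    if perm: "\<alpha> permutes S" "\<beta> permutes S" and p: "p \<in> S"
      and e: "\<And>p. p \<in> S \<Longrightarrow> e (\<alpha> p) = c p" "\<And>p. p \<in> S \<Longrightarrow> e (\<beta> p) = c p"
      and mono: "\<And>p q. p \<in> S \<Longrightarrow> q \<in> S \<Longrightarrow> p < q \<Longrightarrow> c p = c q \<Longrightarrow> \<beta> p < \<beta> q"
      and less: "\<alpha> p < \<beta> p" and IH: "\<And>q. q < p \<Longrightarrow> q \<in> S \<Longrightarrow> \<alpha> q = \<beta> q" for \<alpha> \<beta> p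
  proof -
    have "\<alpha> p \<in> \<beta> ` S"
      using p permutes_in_image[OF perm(1)] permutes_image[OF perm(2)] by blast
    then obtain q where q: "q \<in> S" "\<alpha> p = \<beta> q"
      by blast
    then have "c q = c p"
      using e p by metis
    then have "q < p"
      using mono[OF p q(1)] less q by (metis linorder_neqE_nat order.strict_trans order.irrefl)
    then show False
      using IH q injD[OF permutes_inj[OF perm(1)]] by (metis less_irrefl)
  qed
  fix p
  show "\<pi> p = \<tau> p"
  proof (induction p rule: less_induct)
    case (less p)
    show ?case
    proof (cases "p \<in> S")
      case True
      have "\<not> \<pi> p < \<tau> p"
        using step[of \<pi> \<tau> p] perm True e mono(2) less.IH by blast
      moreover have "\<not> \<tau> p < \<pi> p"
        using step[of \<tau> \<pi> p] perm True e mono(1) less.IH by (metis (no_types, lifting))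
      ultimately show ?thesis
        by simp
    next
      case False
      then show ?thesis
        using perm by (simp add: permutes_not_in)
    qed
  qed
qed

text \<open>The map \<open>F\<close> records the colours of \<open>n\<close> positions and of
  \<open>n\<close> values, each one of \<open>d\<close>. Antisymmetry recovers the other halves, and
  \<open>perm_eq_if_colours_eq\<close> then recovers the permutation.\<close>

lemma card_rc_slice_le:
  "card (rc_slice (Av (Suc d) (decreasing_perm (Suc d))) (2 * n)) \<le> d ^ (2 * n)"
proof -
  let ?A = "rc_slice (Av (Suc d) (decreasing_perm (Suc d))) (2 * n)"
  let ?W = "{1..n} \<rightarrow>\<^sub>E {1..d}"
  define val where "val \<pi> = (\<lambda>v. half_colour d n \<pi> (inv \<pi> v))" for \<pi>
  define F where "F \<pi> = (restrict (half_colour d n \<pi>) {1..n}, restrict (val \<pi>) {1..n})" for \<pi>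
  have inv_mem: "inv \<pi> v \<in> {1..2*n}" if "\<pi> \<in> ?A" "v \<in> {1..2*n}" for \<pi> v
    using permutes_in_image[OF permutes_inv[OF half_colour_properties(1)[OF that(1)]]] that(2)
    by blast
  \<comment> \<open>The inverse of a centrosymmetric permutation also commutes with the reflection,
    so the colouring of values inherits antisymmetry.\<close>
  have val_refl: "val \<pi> (2*n+1-v) = d + 1 - val \<pi> v" if \<pi>: "\<pi> \<in> ?A" and v: "v \<in> {1..2*n}" for \<pi> v
  proof -
    note h = half_colour_properties[OF \<pi>]
    let ?p = "inv \<pi> v"
    have "\<pi> (2*n+1-?p) = 2*n+1-v"
      using h(2)[OF inv_mem[OF \<pi> v]] permutes_inverses(1)[OF h(1)] by simp
    then have "inv \<pi> (2*n+1-v) = 2*n+1-?p"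
      using permutes_inverses(2)[OF h(1)] by metis
    then show ?thesis
      using h(4)[OF inv_mem[OF \<pi> v]] by (simp add: val_def)
  qed
  have ext: "f p = g p"
    if "\<And>p. p \<in> {1..n} \<Longrightarrow> f p = g p" "\<And>p. p \<in> {1..2*n} \<Longrightarrow> f (2*n+1-p) = d + 1 - f p"
      "\<And>p. p \<in> {1..2*n} \<Longrightarrow> g (2*n+1-p) = d + 1 - g p" "p \<in> {1..2*n}" for f g :: "nat \<Rightarrow> nat" and p
  proof (cases "p \<le> n")
    case True
    then show ?thesis using that by auto
  next
    case False
    then have "2*n+1-p \<in> {1..n}" "2*n+1-p \<in> {1..2*n}" "2*n+1-(2*n+1-p) = p"
      using that(4) by auto
    then show ?thesis
      using that(1-3)[of "2*n+1-p"] by simp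
  qed
  have "inj_on F ?A"
  proof (rule inj_onI)
    fix \<pi> \<tau> assume \<pi>: "\<pi> \<in> ?A" and \<tau>: "\<tau> \<in> ?A" and eq: "F \<pi> = F \<tau>"
    note h = half_colour_properties[OF \<pi>] and k = half_colour_properties[OF \<tau>]
    have on_half: "half_colour d n \<pi> p = half_colour d n \<tau> p" "val \<pi> p = val \<tau> p"
      if "p \<in> {1..n}" for p
    proof -
      have "restrict (half_colour d n \<pi>) {1..n} p = restrict (half_colour d n \<tau>) {1..n} p"
        "restrict (val \<pi>) {1..n} p = restrict (val \<tau>) {1..n} p"
        using eq by (simp_all add: F_def)
      then show "half_colour d n \<pi> p = half_colour d n \<tau> p" "val \<pi> p = val \<tau> p"
        using that by simp_all
    qed
    have col: "half_colour d n \<pi> p = half_colour d n \<tau> p" if "p \<in> {1..2*n}" for p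
      by (rule ext[where f = "half_colour d n \<pi>" and g = "half_colour d n \<tau>", OF on_half(1) h(4) k(4) that])
    have valeq: "val \<pi> p = val \<tau> p" if "p \<in> {1..2*n}" for p
      by (rule ext[where f = "val \<pi>" and g = "val \<tau>", OF on_half(2) val_refl[OF \<pi>] val_refl[OF \<tau>] that])
    show "\<pi> = \<tau>"
    proof (rule perm_eq_if_colours_eq[OF h(1) k(1)])
      show "val \<pi> (\<pi> p) = half_colour d n \<pi> p" for p
        using permutes_inverses(2)[OF h(1)] by (simp add: val_def)
      \<comment> \<open>Here the equality of the two value colourings is needed at
        \<open>\<tau> p\<close>, which may lie in either half.\<close>
      show "val \<pi> (\<tau> p) = half_colour d n \<pi> p" if "p \<in> {1..2*n}" for p
        using permutes_inverses(2)[OF k(1)] valeq[of "\<tau> p"] col that permutes_in_image[OF k(1)]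
        by (simp add: val_def)
      show "\<pi> p < \<pi> q" if "p \<in> {1..2*n}" "q \<in> {1..2*n}" "p < q"
        "half_colour d n \<pi> p = half_colour d n \<pi> q" for p q
        using h(5) that by blast
      show "\<tau> p < \<tau> q" if "p \<in> {1..2*n}" "q \<in> {1..2*n}" "p < q"
        "half_colour d n \<pi> p = half_colour d n \<pi> q" for p q
        using k(5) that col by simp
    qed
  qed
  moreover have "F ` ?A \<subseteq> ?W \<times> ?W"
  proof
    fix z assume "z \<in> F ` ?A"
    then obtain \<pi> where \<pi>: "\<pi> \<in> ?A" "z = F \<pi>"
      by blast
    have sub: "p \<in> {1..2*n}" if "p \<in> {1..n}" for p
      using that by auto
    have "restrict (half_colour d n \<pi>) {1..n} \<in> ?W" "restrict (val \<pi>) {1..n} \<in> ?W"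
      using half_colour_properties(3)[OF \<pi>(1)] inv_mem[OF \<pi>(1)] sub
      by (auto simp: val_def simp del: atLeastAtMost_iff)
    then show "z \<in> ?W \<times> ?W"
      using \<pi>(2) by (simp add: F_def)
  qed
  ultimately have "card ?A \<le> card (?W \<times> ?W)"
    by (intro card_inj_on_le) (auto intro!: finite_PiE)
  then show ?thesis
    by (simp add: card_cartesian_product card_PiE power_add mult_2)
qed

subsection \<open>Permutations from pairs of ballot words\<close>

text \<open>A locally checkable form of the greedy colouring, with colours counted from 0. The last
  clause yields, step by step, a decreasing chain of length \<open>c p + 1\<close> ending at
  \<open>p\<close>.\<close>

definition layered :: "nat \<Rightarrow> nat \<Rightarrow> (nat \<Rightarrow> nat) \<Rightarrow> (nat \<Rightarrow> nat) \<Rightarrow> bool" where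
  "layered d n \<pi> c \<longleftrightarrow>
     (\<forall>p\<in>{1..n}. c p < d) \<and>
     (\<forall>p\<in>{1..n}. \<forall>q\<in>{1..n}. p < q \<and> c p = c q \<longrightarrow> \<pi> p < \<pi> q) \<and>
     (\<forall>p\<in>{1..n}. \<forall>j. c p = Suc j \<longrightarrow> (\<exists>q\<in>{1..n}. q < p \<and> \<pi> p < \<pi> q \<and> c q = j))"

text \<open>Induction on the colour of the left point \<open>x\<close>: its witness \<open>y\<close>
  also lies to the left of \<open>q\<close> and above it, so \<open>c y < c q\<close> and thus
  \<open>c x \<le> c q\<close>. Equality is impossible because colour classes are
  increasing.\<close>

lemma layered_less:
  assumes "layered d n \<pi> c" "p \<in> {1..n}" "q \<in> {1..n}" "p < q" "\<pi> q < \<pi> p"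
  shows "c p < c q"
proof (rule ccontr)
  assume "\<not> c p < c q"
  moreover have "c x < c q" if "x \<in> {1..n}" "x < q" "\<pi> q < \<pi> x" for x
    using that
  proof (induction "c x" arbitrary: x)
    case 0
    then have "c x \<noteq> c q"
      using assms(1,3) unfolding layered_def by (metis order.asym)
    then show ?case
      using 0 by simp
  next
    case (Suc j)
    then obtain y where y: "y \<in> {1..n}" "y < x" "\<pi> x < \<pi> y" "c y = j"
      using assms(1) unfolding layered_def by metis
    then have "c y < c q"
      using Suc by (metis order.strict_trans)
    moreover have "c x \<noteq> c q"
      using assms(1,3) Suc unfolding layered_def by (metis order.asym)
    ultimately show ?case
      using y(4) Suc(2) by simp
  qed
  ultimately show False
    using assms by blast
qed

text \<open>A layered colouring is the length of the longest decreasing subsequence ending at each point,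
  hence determined by the permutation.\<close>

lemma layered_unique:
  assumes "layered d n \<pi> c" "layered d n \<pi> e" "p \<in> {1..n}"
  shows "c p = e p"
proof -
  have le: "c p \<le> e p"
    if c: "layered d n \<pi> c" and e: "layered d n \<pi> e" and p: "p \<in> {1..n}" for c e p
    using p
  proof (induction "c p" arbitrary: p)
    case (Suc j)
    then obtain y where y: "y \<in> {1..n}" "y < p" "\<pi> p < \<pi> y" "c y = j"
      using c unfolding layered_def by metis
    then have "c y \<le> e y" "e y < e p"
      using Suc layered_less[OF e] by auto
    then show ?case
      using y(4) Suc(2) by simp
  qed simp
  show ?thesis
    using le[OF assms] le[OF assms(2,1,3)] by simp
qed

text \<open>By \<open>layered_less\<close> the colouring is injective on a decreasing set, and there
  are only \<open>d\<close> colours.\<close>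

lemma layered_imp_Av:
  assumes perm: "\<pi> permutes {1..n}" and lay: "layered d n \<pi> c"
  shows "\<pi> \<in> Av (Suc d) (decreasing_perm (Suc d)) n"
proof -
  have "card S \<le> d" if S: "S \<subseteq> {1..n}" "dec_set \<pi> S" for S
  proof -
    have less: "c x < c y" if "x \<in> S" "y \<in> S" "x < y" for x y
      using layered_less[OF lay, of x y] that S dec_setD by blast
    then have "inj_on c S"
      by (metis inj_onI linorder_neqE_nat order.irrefl)
    moreover have "c ` S \<subseteq> {..<d}"
      using lay S(1) by (auto simp: layered_def)
    ultimately show ?thesis
      using card_inj_on_le[of c S "{..<d}"] by simp
  qed
  then show ?thesis
    using perm by (simp add: Av_decreasing_iff)
qed

section \<open>Ballot words and the permutations they encode\<close>

definition balanced_words :: "nat \<Rightarrow> nat \<Rightarrow> nat list set" where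
  "balanced_words d m = {w. set w \<subseteq> {..<d} \<and> (\<forall>j<d. count_list w j = m)}"

text \<open>These are lattice words; the balanced ones encode standard Young tableaux of rectangular
  shape, the letter at a position naming its row.\<close>

definition ballot :: "nat \<Rightarrow> nat list \<Rightarrow> bool" where
  "ballot d w \<longleftrightarrow>
     (\<forall>t j. Suc j < d \<longrightarrow> count_list (take t w) (Suc j) \<le> count_list (take t w) j)"

lemma length_balanced_words: "w \<in> balanced_words d m \<Longrightarrow> length w = d * m"
  using sum_count_set[of w "{..<d}"] by (simp add: balanced_words_def)

lemma finite_balanced_words: "finite (balanced_words d m)"
  by (rule finite_subset[OF _ finite_lists_length_eq[of "{..<d}" "d * m"]])
    (use length_balanced_words in \<open>auto simp: balanced_words_def\<close>)

lemma count_list_take_eq_card: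
  assumes "t \<le> length w"
  shows "count_list (take t w) x = card {p. p < t \<and> w ! p = x}"
proof -
  have "{i. i < length (take t w) \<and> take t w ! i = x} = {p. p < t \<and> w ! p = x}"
    using assms by auto
  then show ?thesis
    by (simp add: count_list_eq_length_filter length_filter_conv_card eq_commute)
qed

text \<open>Here \<open>h j i\<close> is the position, counted from 1, of occurrence
  \<open>i\<close> of the letter \<open>j\<close>, with \<open>i\<close> counted from 0. The last
  property, increase along tableau columns, is where the ballot condition enters.\<close>

lemma ballot_word_enumeration:
  assumes w: "w \<in> balanced_words d m" and bal: "ballot d w"
  obtains h :: "nat \<Rightarrow> nat \<Rightarrow> nat" where
    "bij_betw (\<lambda>(j, i). h j i) ({..<d} \<times> {..<m}) {1..d*m}"
    "\<And>j i. j < d \<Longrightarrow> i < m \<Longrightarrow> w ! (h j i - 1) = j"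
    "\<And>j i i'. j < d \<Longrightarrow> i < i' \<Longrightarrow> i' < m \<Longrightarrow> h j i < h j i'"
    "\<And>j i. Suc j < d \<Longrightarrow> i < m \<Longrightarrow> h j i < h (Suc j) i"
proof -
  define A where "A j = {p. p < d * m \<and> w ! p = j}" for j
  have len: "length w = d * m"
    using length_balanced_words[OF w] .
  have cardA: "card (A j) = m" if "j < d" for j
    using that w count_list_take_eq_card[of "d*m" w j] len by (simp add: A_def balanced_words_def)
  have "\<exists>h. bij_betw h {..<m} (A j) \<and> strict_mono_on {..<m} h" if "j < d" for j
  proof -
    have "finite (A j)"
      by (simp add: A_def)
    then show ?thesis
      using ex_bij_betw_strict_mono_card[of "A j"] cardA[OF that] by metis
  qed
  then obtain g where g: "\<And>j. j < d \<Longrightarrow> bij_betw (g j) {..<m} (A j)"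
    and mono: "\<And>j. j < d \<Longrightarrow> strict_mono_on {..<m} (g j)"
    by metis
  have mem: "g j i < d * m" "w ! g j i = j" if "j < d" "i < m" for j i
    using that bij_betwE[OF g[OF that(1)]] by (auto simp: A_def)
  have less: "g j i < g j i'" if "j < d" "i < i'" "i' < m" for j i i'
    using strict_mono_onD[OF mono[OF that(1)]] that by simp
  have step: "g j i < g (Suc j) i" if ji: "Suc j < d" "i < m" for j i
  proof (rule ccontr)
    assume "\<not> g j i < g (Suc j) i"
    moreover have "g j i \<noteq> g (Suc j) i"
      using mem(2)[of j i] mem(2)[of "Suc j" i] ji by force
    ultimately have gt: "g (Suc j) i < g j i"
      by simp
    \<comment> \<open>The prefix ending with occurrence \<open>i\<close> of \<open>Suc j\<close> has
      \<open>i + 1\<close> letters \<open>Suc j\<close> but, under the assumption \<open>gt\<close>,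
      at most \<open>i\<close> letters \<open>j\<close>.\<close>
    let ?t = "Suc (g (Suc j) i)"
    have t: "?t \<le> length w"
      using mem(1)[of "Suc j" i] ji len by simp
    have "g (Suc j) ` {..i} \<subseteq> {p. p < ?t \<and> w ! p = Suc j}"
    proof safe
      fix i' assume "i' \<le> i"
      then show "g (Suc j) i' < ?t"
        using less[of "Suc j" i' i] ji by (cases "i' = i") auto
      show "w ! g (Suc j) i' = Suc j"
        using mem(2) ji \<open>i' \<le> i\<close> by simp
    qed
    moreover have "card (g (Suc j) ` {..i}) = Suc i"
    proof -
      have "inj_on (g (Suc j)) {..i}"
        using g[OF ji(1)] ji(2) inj_on_subset[of "g (Suc j)" "{..<m}" "{..i}"]
        by (simp add: bij_betw_def subset_iff)
      then show ?thesis
        by (simp add: card_image)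
    qed
    ultimately have "Suc i \<le> card {p. p < ?t \<and> w ! p = Suc j}"
      using card_mono[of "{p. p < ?t \<and> w ! p = Suc j}" "g (Suc j) ` {..i}"] by simp
    also have "\<dots> \<le> card {p. p < ?t \<and> w ! p = j}"
      using bal ji unfolding ballot_def count_list_take_eq_card[OF t, symmetric] by blast
    also have "\<dots> \<le> card (g j ` {..<i})"
    proof (rule card_mono)
      show "{p. p < ?t \<and> w ! p = j} \<subseteq> g j ` {..<i}"
      proof
        fix p assume "p \<in> {p. p < ?t \<and> w ! p = j}"
        then have p: "p < ?t" "w ! p = j"
          by auto
        then have "p \<in> A j"
          using t len by (simp add: A_def)
        then obtain i' where i': "i' < m" "p = g j i'"
          using g[of j] ji by (auto simp: bij_betw_def)
        have "\<not> i \<le> i'"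
          using less[of j i i'] i' p(1) gt ji by (cases "i = i'") auto
        then show "p \<in> g j ` {..<i}"
          using i' p by auto
      qed
    qed simp
    also have "\<dots> \<le> i"
      using card_image_le[of "{..<i}" "g j"] by simp
    finally show False
      by simp
  qed
  show thesis
  proof
    show "bij_betw (\<lambda>(j, i). Suc (g j i)) ({..<d} \<times> {..<m}) {1..d*m}"
    proof (rule bij_betwI')
      fix x y assume xy: "x \<in> {..<d} \<times> {..<m}" "y \<in> {..<d} \<times> {..<m}"
      obtain j i j' i' where [simp]: "x = (j, i)" "y = (j', i')"
        by (metis surj_pair)
      have "j = j' \<and> i = i'" if eq: "g j i = g j' i'"
      proof -
        have "j = j'"
          using eq mem(2)[of j i] mem(2)[of j' i'] xy by simp
        then show ?thesis
          using eq g[of j] xy by (auto simp: bij_betw_def inj_on_def)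
      qed
      then show "((case x of (j, i) \<Rightarrow> Suc (g j i)) = (case y of (j, i) \<Rightarrow> Suc (g j i))) = (x = y)"
        by auto
    next
      fix x assume "x \<in> {..<d} \<times> {..<m}"
      then show "(case x of (j, i) \<Rightarrow> Suc (g j i)) \<in> {1..d*m}"
        using mem(1) by (auto simp: Suc_le_eq)
    next
      fix p assume p: "p \<in> {1..d*m}"
      then have pl: "p - 1 < length w"
        using len by auto
      then have j: "w ! (p - 1) < d"
        using w nth_mem by (force simp: balanced_words_def)
      have "p - 1 \<in> A (w ! (p - 1))"
        using pl len by (simp add: A_def)
      then obtain i where "i < m" "p - 1 = g (w ! (p - 1)) i"
        using g[OF j] by (auto simp: bij_betw_def)
      then show "\<exists>x\<in>{..<d} \<times> {..<m}. p = (case x of (j, i) \<Rightarrow> Suc (g j i))"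
        using p j by (intro bexI[of _ "(w ! (p - 1), i)"]) auto
    qed
  qed (use mem less step in auto)
qed

text \<open>Occurrence \<open>i\<close> of \<open>j\<close> in \<open>u\<close> is sent to
  occurrence \<open>i\<close> of \<open>d - 1 - j\<close> in \<open>v\<close>. Complementing the
  letter makes values fall as the letter rises, so occurrence \<open>i\<close> of the preceding
  letter in \<open>u\<close> is the witness required by \<open>layered\<close>.\<close>

lemma ballot_pair_permutation:
  assumes u: "u \<in> balanced_words d m" "ballot d u" and v: "v \<in> balanced_words d m" "ballot d v"
  obtains \<pi> where "\<pi> permutes {1..d*m}" "layered d (d*m) \<pi> (\<lambda>p. u ! (p - 1))"
    "\<And>p. p \<in> {1..d*m} \<Longrightarrow> v ! (\<pi> p - 1) = d - 1 - u ! (p - 1)"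
proof -
  let ?n = "d * m"
  let ?X = "{..<d} \<times> {..<m}"
  obtain h where h: "bij_betw (\<lambda>(j, i). h j i) ?X {1..?n}"
    "\<And>j i. j < d \<Longrightarrow> i < m \<Longrightarrow> u ! (h j i - 1) = j"
    "\<And>j i i'. j < d \<Longrightarrow> i < i' \<Longrightarrow> i' < m \<Longrightarrow> h j i < h j i'"
    "\<And>j i. Suc j < d \<Longrightarrow> i < m \<Longrightarrow> h j i < h (Suc j) i"
    using ballot_word_enumeration[OF u] by metis
  obtain g where g: "bij_betw (\<lambda>(j, i). g j i) ?X {1..?n}"
    "\<And>j i. j < d \<Longrightarrow> i < m \<Longrightarrow> v ! (g j i - 1) = j"
    "\<And>j i i'. j < d \<Longrightarrow> i < i' \<Longrightarrow> i' < m \<Longrightarrow> g j i < g j i'"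
    "\<And>j i. Suc j < d \<Longrightarrow> i < m \<Longrightarrow> g j i < g (Suc j) i"
    using ballot_word_enumeration[OF v] by metis
  let ?H = "\<lambda>(j, i). h j i" and ?G = "\<lambda>(j, i). g (d - 1 - j) i"
  have flip: "bij_betw (\<lambda>(j, i). (d - 1 - j, i)) ?X ?X"
    by (rule bij_betw_byWitness[where f' = "\<lambda>(j, i). (d - 1 - j, i)"]) auto
  have G: "bij_betw ?G ?X {1..?n}"
    using bij_betw_trans[OF flip g(1)] by (simp add: comp_def case_prod_unfold)
  define \<pi> where "\<pi> p = (if p \<in> {1..?n} then ?G (inv_into ?X ?H p) else p)" for p
  have pi_h: "\<pi> (h j i) = g (d - 1 - j) i" if "j < d" "i < m" for j i
  proof -
    have "h j i \<in> {1..?n}"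
      using bij_betwE[OF h(1)] that by fastforce
    moreover have "inv_into ?X ?H (h j i) = (j, i)"
      using bij_betw_inv_into_left[OF h(1), of "(j, i)"] that by simp
    ultimately show ?thesis
      by (simp add: \<pi>_def)
  qed
  have h_surj: "\<exists>j i. j < d \<and> i < m \<and> p = h j i" if "p \<in> {1..?n}" for p
  proof -
    have "p \<in> ?H ` ?X"
      using that h(1) by (simp add: bij_betw_def)
    then show ?thesis
      by auto
  qed
  have h_mem: "h j i \<in> {1..?n}" if "j < d" "i < m" for j i
    using bij_betwE[OF h(1)] that by fastforce
  have "bij_betw (?G \<circ> inv_into ?X ?H) {1..?n} {1..?n}"
    using bij_betw_trans[OF bij_betw_inv_into[OF h(1)] G] .
  then have "bij_betw \<pi> {1..?n} {1..?n}"
    by (rule bij_betw_cong[THEN iffD1, rotated]) (simp add: \<pi>_def)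
  then have perm: "\<pi> permutes {1..?n}"
    by (rule bij_imp_permutes) (auto simp: \<pi>_def)
  have "layered d ?n \<pi> (\<lambda>p. u ! (p - 1))"
    unfolding layered_def
  proof (intro conjI ballI allI impI)
    fix p assume "p \<in> {1..?n}"
    then show "u ! (p - 1) < d"
      using h_surj h(2) by force
  next
    fix p q assume pq: "p \<in> {1..?n}" "q \<in> {1..?n}" "p < q \<and> u ! (p - 1) = u ! (q - 1)"
    obtain j i where ji: "j < d" "i < m" "p = h j i"
      using h_surj pq(1) by blast
    obtain j' i' where ji': "j' < d" "i' < m" "q = h j' i'"
      using h_surj pq(2) by blast
    have "j = j'"
      using h(2) ji ji' pq(3) by simp
    have "i < i'"
    proof (rule ccontr)
      assume "\<not> i < i'"
      then show False
        using h(3)[of j i' i] ji ji' pq(3) \<open>j = j'\<close> by (cases "i = i'") auto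
    qed
    then show "\<pi> p < \<pi> q"
      using pi_h ji ji' \<open>j = j'\<close> g(3) by simp
  next
    fix p k assume p: "p \<in> {1..?n}" "u ! (p - 1) = Suc k"
    obtain j i where ji: "j < d" "i < m" "p = h j i"
      using h_surj p(1) by blast
    then have j: "j = Suc k"
      using h(2) p(2) by simp
    have "d - 1 - k = Suc (d - 1 - Suc k)"
      using ji j by simp
    then have "\<pi> p < \<pi> (h k i)"
      using pi_h ji j g(4)[of "d - 1 - Suc k" i] by simp
    then show "\<exists>q\<in>{1..?n}. q < p \<and> \<pi> p < \<pi> q \<and> u ! (q - 1) = k"
      using h_mem[of k i] h(2)[of k i] h(4)[of k i] ji j by (intro bexI[of _ "h k i"]) auto
  qed
  moreover have "v ! (\<pi> p - 1) = d - 1 - u ! (p - 1)" if p: "p \<in> {1..?n}" for p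
  proof -
    obtain j i where ji: "j < d" "i < m" "p = h j i"
      using h_surj p by blast
    then show ?thesis
      using pi_h g(2)[of "d - 1 - j" i] h(2) by simp
  qed
  ultimately show thesis
    using that perm by blast
qed

text \<open>The first word is recovered as the only layered colouring of the permutation; the second
  is then read off at the values, which exhaust all positions of the word.\<close>

lemma card_ballot_words_le:
  "(card {w \<in> balanced_words d m. ballot d w})\<^sup>2 \<le> card (Av (Suc d) (decreasing_perm (Suc d)) (d * m))"
proof -
  let ?W = "{w \<in> balanced_words d m. ballot d w}"
  let ?n = "d * m"
  define R where "R z \<pi> \<longleftrightarrow> \<pi> permutes {1..?n} \<and> layered d ?n \<pi> (\<lambda>p. fst z ! (p - 1)) \<and>
      (\<forall>p\<in>{1..?n}. snd z ! (\<pi> p - 1) = d - 1 - fst z ! (p - 1))" for z \<pi>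
  have "\<exists>\<pi>. R z \<pi>" if "z \<in> ?W \<times> ?W" for z
  proof -
    have "fst z \<in> balanced_words d m" "ballot d (fst z)" "snd z \<in> balanced_words d m" "ballot d (snd z)"
      using that by auto
    from ballot_pair_permutation[OF this] show ?thesis
      unfolding R_def by metis
  qed
  then obtain \<Phi> where R: "\<And>z. z \<in> ?W \<times> ?W \<Longrightarrow> R z (\<Phi> z)"
    by metis
  have \<Phi>: "\<Phi> z permutes {1..?n}" "layered d ?n (\<Phi> z) (\<lambda>p. fst z ! (p - 1))"
    "p \<in> {1..?n} \<Longrightarrow> snd z ! (\<Phi> z p - 1) = d - 1 - fst z ! (p - 1)" if "z \<in> ?W \<times> ?W" for z p
    using R[OF that] by (simp_all add: R_def)
  have "inj_on \<Phi> (?W \<times> ?W)"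
  proof (rule inj_onI)
    fix y z assume y: "y \<in> ?W \<times> ?W" and z: "z \<in> ?W \<times> ?W" and eq: "\<Phi> y = \<Phi> z"
    have len: "length (fst y) = ?n" "length (snd y) = ?n" "length (fst z) = ?n" "length (snd z) = ?n"
      using y z length_balanced_words by auto
    have col: "fst y ! (p - 1) = fst z ! (p - 1)" if "p \<in> {1..?n}" for p
      using layered_unique[OF \<Phi>(2)[OF y]] \<Phi>(2)[OF z] eq that by simp
    have "fst y = fst z"
    proof (rule nth_equalityI)
      fix i assume "i < length (fst y)"
      then show "fst y ! i = fst z ! i"
        using col[of "Suc i"] len by simp
    qed (simp add: len)
    moreover have "snd y = snd z"
    proof (rule nth_equalityI)
      fix i assume i: "i < length (snd y)"
      then have "Suc i \<in> \<Phi> y ` {1..?n}"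
        using permutes_image[OF \<Phi>(1)[OF y]] len by simp
      then obtain p where p: "p \<in> {1..?n}" "\<Phi> y p = Suc i"
        by (metis imageE)
      then show "snd y ! i = snd z ! i"
        using \<Phi>(3)[OF y p(1)] \<Phi>(3)[OF z p(1)] eq col[OF p(1)] by simp
    qed (simp add: len)
    ultimately show "y = z"
      by (simp add: prod_eq_iff)
  qed
  moreover have "\<Phi> ` (?W \<times> ?W) \<subseteq> Av (Suc d) (decreasing_perm (Suc d)) ?n"
    using layered_imp_Av \<Phi>(1,2) by blast
  ultimately have "card (?W \<times> ?W) \<le> card (Av (Suc d) (decreasing_perm (Suc d)) ?n)"
    by (rule card_inj_on_le) (rule finite_Av)
  then show ?thesis
    by (simp add: card_cartesian_product power2_eq_square)
qed

subsection \<open>Counting ballot words\<close>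

text \<open>Supplies the prefix and the suffix placed around the balanced blocks.\<close>

lemma exists_sorted_word:
  fixes d :: nat
  shows "\<exists>w. sorted w \<and> set w \<subseteq> {..<d} \<and> (\<forall>j<d. count_list w j = c j)"
proof (induction d)
  case (Suc d)
  then obtain w where w: "sorted w" "set w \<subseteq> {..<d}" "\<forall>j<d. count_list w j = c j"
    by blast
  have rep: "count_list (replicate r x) y = (if x = y then r else 0)" for r and x y :: nat
    by (induction r) auto
  have "sorted (w @ replicate (c d) d)"
    using w(1,2) by (auto simp: sorted_append subset_iff order_less_imp_le)
  moreover have "set (w @ replicate (c d) d) \<subseteq> {..<Suc d}"
    using w(2) by auto
  moreover have "count_list w d = 0"
    using w(2) by (auto simp: count_list_0_iff)
  then have "\<forall>j<Suc d. count_list (w @ replicate (c d) d) j = c j"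
    using w(3) by (auto simp: rep less_Suc_eq)
  ultimately show ?case
    by blast
qed simp

lemma count_take_le: "count_list (take t w) x \<le> count_list w x"
  using count_list_append[of "take t w" "drop t w" x] by simp

text \<open>In a sorted word all smaller letters are used up once a larger one has appeared.\<close>

lemma count_take_sorted:
  assumes "sorted w" "x < y" "y \<in> set (take t w)"
  shows "count_list (take t w) x = count_list w x"
proof -
  have "sorted (take t w @ drop t w)"
    using assms(1) by simp
  then have "x \<notin> set (drop t w)"
    using assms(2,3) unfolding sorted_append by (meson leD)
  then show ?thesis
    using count_list_append[of "take t w" "drop t w" x] by simp
qed

text \<open>Either \<open>y\<close> has not occurred yet, or \<open>x\<close> is exhausted and the
  final comparison applies. The offsets \<open>a\<close> and \<open>b\<close> stand for the counts
  in whatever precedes \<open>w\<close>.\<close>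

lemma count_take_sorted_le:
  assumes "sorted w" "x < y" "b \<le> (a::nat)" "b + count_list w y \<le> a + count_list w x"
  shows "b + count_list (take t w) y \<le> a + count_list (take t w) x"
proof (cases "y \<in> set (take t w)")
  case True
  then show ?thesis
    using count_take_sorted[OF assms(1,2) True] count_take_le[of t w y] assms(4) by linarith
qed (use assms(3) in simp)

text \<open>Complete blocks contribute equally to both letters; the one block that is cut
  contributes at most \<open>B\<close> to either.\<close>

lemma count_take_concat_balanced:
  assumes "set ls \<subseteq> balanced_words d B" "x < d" "y < d"
  shows "count_list (take t (concat ls)) y \<le> count_list (take t (concat ls)) x + B"
  using assms(1)
proof (induction ls arbitrary: t)
  case (Cons w ls)
  then have w: "count_list w x = B" "count_list w y = B"
    using assms by (auto simp: balanced_words_def)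
  show ?case
  proof (cases "t \<le> length w")
    case True
    then show ?thesis
      using count_take_le[of t w y] w by simp
  next
    case False
    then show ?thesis
      using Cons w by simp
  qed
qed simp

lemma count_concat_balanced:
  assumes "set ls \<subseteq> balanced_words d B" "x < d"
  shows "count_list (concat ls) x = length ls * B"
  using assms by (induction ls) (auto simp: balanced_words_def)

text \<open>The lead of \<open>B\<close> given by the prefix is exactly what a cut block may
  consume. In the suffix each letter catches up only after its predecessor is exhausted, and the two
  sorted words together add \<open>d - 1\<close> times \<open>B\<close> to every letter.\<close>

lemma ballot_sandwich:
  assumes ls: "set ls \<subseteq> balanced_words d B" "length ls = T"
    and pre: "sorted pre" "set pre \<subseteq> {..<d}" "\<And>j. j < d \<Longrightarrow> count_list pre j = (d - 1 - j) * B"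
    and suf: "sorted suf" "set suf \<subseteq> {..<d}" "\<And>j. j < d \<Longrightarrow> count_list suf j = j * B"
  shows "pre @ concat ls @ suf \<in> balanced_words d ((T + (d - 1)) * B)"
    and "ballot d (pre @ concat ls @ suf)"
proof -
  have "(d - 1 - j) * B + (T * B + j * B) = (T + (d - 1)) * B" if "j < d" for j
  proof -
    have "(d - 1 - j) + (T + j) = T + (d - 1)"
      using that by simp
    then show ?thesis
      by (metis add_mult_distrib)
  qed
  moreover have "set (concat ls) \<subseteq> {..<d}"
    using ls(1) by (auto simp: balanced_words_def)
  ultimately show "pre @ concat ls @ suf \<in> balanced_words d ((T + (d - 1)) * B)"
    using pre(2,3) suf(2,3) count_concat_balanced[OF ls(1)] ls(2) by (auto simp: balanced_words_def)
  show "ballot d (pre @ concat ls @ suf)"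
    unfolding ballot_def
  proof (intro allI impI)
    fix t j assume j: "Suc j < d"
    let ?c = "\<lambda>w. count_list w"
    have gap: "?c pre (Suc j) + B = ?c pre j"
    proof -
      have "Suc (d - 1 - Suc j) = d - 1 - j"
        using j by simp
      then show ?thesis
        using pre(3)[of j] pre(3)[of "Suc j"] j by (metis Suc_lessD add.commute mult_Suc)
    qed
    consider "t \<le> length pre" | "length pre < t" "t \<le> length pre + length (concat ls)"
      | "length pre + length (concat ls) < t"
      by linarith
    then show "?c (take t (pre @ concat ls @ suf)) (Suc j) \<le> ?c (take t (pre @ concat ls @ suf)) j"
    proof cases
      case 1
      then show ?thesis
        using count_take_sorted_le[OF pre(1), of j "Suc j" 0 0 t] gap by simp
    next
      case 2
      then show ?thesis
        using count_take_concat_balanced[OF ls(1), of j "Suc j" "t - length pre"] j gap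
        by (simp del: length_concat)
    next
      case 3
      have eq: "?c (concat ls) j = ?c (concat ls) (Suc j)"
        using count_concat_balanced[OF ls(1)] j by simp
      let ?s = "take (t - length pre - length (concat ls)) suf"
      have "?c pre (Suc j) + ?c (concat ls) (Suc j) + ?c ?s (Suc j)
          \<le> ?c pre j + ?c (concat ls) j + ?c ?s j"
        using gap eq suf(3) j by (intro count_take_sorted_le[OF suf(1)]) auto
      then show ?thesis
        using 3 by (simp del: length_concat)
    qed
  qed
qed

text \<open>All blocks have length \<open>d * B\<close>, so the concatenation determines its
  blocks.\<close>

lemma card_balanced_power_le:
  "card (balanced_words d B) ^ T
     \<le> card {w \<in> balanced_words d ((T + (d - 1)) * B). ballot d w}"
proof -
  obtain pre where pre: "sorted pre" "set pre \<subseteq> {..<d}"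
    "\<And>j. j < d \<Longrightarrow> count_list pre j = (d - 1 - j) * B"
    using exists_sorted_word[of d "\<lambda>j. (d - 1 - j) * B"] by blast
  obtain suf where suf: "sorted suf" "set suf \<subseteq> {..<d}"
    "\<And>j. j < d \<Longrightarrow> count_list suf j = j * B"
    using exists_sorted_word[of d "\<lambda>j. j * B"] by blast
  let ?L = "{ls. set ls \<subseteq> balanced_words d B \<and> length ls = T}"
  have "inj_on (\<lambda>ls. pre @ concat ls @ suf) ?L"
  proof (rule inj_onI)
    fix xs ys assume xs: "xs \<in> ?L" and ys: "ys \<in> ?L" and "pre @ concat xs @ suf = pre @ concat ys @ suf"
    then have eq: "concat xs = concat ys"
      by simp
    have "length x = length y" if "(x, y) \<in> set (zip xs ys)" for x y
    proof -
      have "x \<in> balanced_words d B" "y \<in> balanced_words d B"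
        using set_zip_leftD[OF that] set_zip_rightD[OF that] xs ys by blast+
      then show ?thesis
        by (simp add: length_balanced_words)
    qed
    then show "xs = ys"
      using eq xs ys by (intro concat_injective) auto
  qed
  then have "card ?L \<le> card {w \<in> balanced_words d ((T + (d - 1)) * B). ballot d w}"
    by (rule card_inj_on_le)
      (use ballot_sandwich[OF _ _ pre suf] finite_balanced_words in auto)
  then show ?thesis
    using card_lists_length_eq[OF finite_balanced_words] by simp
qed

section \<open>The number of balanced words\<close>

lemma count_list_map_inj:
  assumes "inj_on f A" "set w \<subseteq> A" "x \<in> A"
  shows "count_list (map f w) (f x) = count_list w x"
  using assms(2) by (induction w) (use assms in \<open>auto dest: inj_onD\<close>)

text \<open>By the pigeonhole principle some content vector is shared by many words of length \<open>B\<close>.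
  Concatenating \<open>d\<close> such words, the \<open>r\<close>-th with its letters shifted cyclically by \<open>r\<close>, gives a
  balanced word.\<close>

lemma card_balanced_words_ge:
  assumes "1 \<le> d"
  shows "d ^ (d * B) \<le> card (balanced_words d B) * (B + 1) ^ (d * d)"
proof -
  let ?W = "{w. set w \<subseteq> {..<d} \<and> length w = B}"
  let ?K = "{..<d} \<rightarrow>\<^sub>E {..B}"
  let ?F = "\<lambda>\<kappa>. {w \<in> ?W. restrict (count_list w) {..<d} = \<kappa>}"
  have finW: "finite ?W"
    by (rule finite_lists_length_eq) simp
  have finK: "finite ?K"
    by (intro finite_PiE) auto
  have "?K \<noteq> {}"
    by (auto simp: PiE_eq_empty_iff)
  then have "Max ((\<lambda>\<kappa>. card (?F \<kappa>)) ` ?K) \<in> (\<lambda>\<kappa>. card (?F \<kappa>)) ` ?K"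
    using finK by (intro Max_in) auto
  then obtain \<kappa> where \<kappa>: "card (?F \<kappa>) = Max ((\<lambda>\<kappa>. card (?F \<kappa>)) ` ?K)"
    by auto
  define F where "F = ?F \<kappa>"
  have "?W \<subseteq> (\<Union>\<mu>\<in>?K. ?F \<mu>)"
  proof
    fix w assume w: "w \<in> ?W"
    then have "restrict (count_list w) {..<d} \<in> ?K"
      using count_le_length[of w] by auto
    then show "w \<in> (\<Union>\<mu>\<in>?K. ?F \<mu>)"
      using w by blast
  qed
  then have "card ?W \<le> card (\<Union>\<mu>\<in>?K. ?F \<mu>)"
    by (intro card_mono finite_subset[OF _ finW]) auto
  also have "\<dots> \<le> (\<Sum>\<mu>\<in>?K. card (?F \<mu>))"
    by (rule card_UN_le[OF finK])
  also have "\<dots> \<le> of_nat (card ?K) * card F"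
  proof (rule sum_bounded_above)
    fix \<mu> assume "\<mu> \<in> ?K"
    then show "card (?F \<mu>) \<le> card F"
      unfolding F_def \<kappa> by (intro Max_ge finite_imageI finK imageI)
  qed
  finally have pigeon: "d ^ B \<le> (B + 1) ^ d * card F"
    by (simp add: card_lists_length_eq card_PiE)
  have F: "set w \<subseteq> {..<d}" "length w = B" "x < d \<Longrightarrow> count_list w x = \<kappa> x" if "w \<in> F" for w x
    using that by (auto simp: F_def)
  \<comment> \<open>\<open>sh r\<close> is addition of \<open>r\<close> modulo \<open>d\<close>, and
    \<open>un j r\<close> is the letter that it sends to \<open>j\<close>. For fixed
    \<open>j\<close>, \<open>un j\<close> is an involution, which later reindexes the sum of the
    content vector.\<close>
  define sh where "sh r x = (if x + r < d then x + r else x + r - d)" for r x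
  define un where "un j r = (if r \<le> j then j - r else j + d - r)" for j r
  have sh_inj: "inj_on (sh r) {..<d}" if "r < d" for r
    using that by (auto simp: inj_on_def sh_def split: if_splits)
  have sh_less: "sh r x < d" if "r < d" "x < d" for r x
    using that by (auto simp: sh_def)
  have un_less: "un j r < d" and sh_un: "sh r (un j r) = j" and un_un: "un j (un j r) = r"
    if "r < d" "j < d" for r j
    using that by (auto simp: sh_def un_def)
  define \<Psi> where "\<Psi> ls = concat (map (\<lambda>r. map (sh r) (ls ! r)) [0..<d])" for ls
  let ?L = "{ls. set ls \<subseteq> F \<and> length ls = d}"
  have "inj_on \<Psi> ?L"
  proof (rule inj_onI)
    fix xs ys assume xs: "xs \<in> ?L" and ys: "ys \<in> ?L" and eq: "\<Psi> xs = \<Psi> ys"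
    have mem: "xs ! r \<in> F" "ys ! r \<in> F" if "r < d" for r
      using that xs ys nth_mem[of r xs] nth_mem[of r ys] by auto
    have "map (\<lambda>r. map (sh r) (xs ! r)) [0..<d] = map (\<lambda>r. map (sh r) (ys ! r)) [0..<d]"
    proof (rule concat_injective)
      show "\<forall>(x, y)\<in>set (zip (map (\<lambda>r. map (sh r) (xs ! r)) [0..<d])
          (map (\<lambda>r. map (sh r) (ys ! r)) [0..<d])). length x = length y"
        using mem F(2) by (auto simp: set_zip)
    qed (use eq in \<open>simp_all add: \<Psi>_def\<close>)
    then have shifted: "map (sh r) (xs ! r) = map (sh r) (ys ! r)" if "r < d" for r
      using that by simp
    have "xs ! r = ys ! r" if "r < d" for r
    proof (rule map_inj_on[OF shifted[OF that]])
      show "inj_on (sh r) (set (xs ! r) \<union> set (ys ! r))"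
        using sh_inj[OF that] F(1) mem[OF that] by (meson Un_least inj_on_subset)
    qed
    then show "xs = ys"
      using xs ys by (intro nth_equalityI) auto
  qed
  moreover have "\<Psi> ` ?L \<subseteq> balanced_words d B"
  proof
    fix w assume "w \<in> \<Psi> ` ?L"
    then obtain ls where ls: "ls \<in> ?L" "w = \<Psi> ls"
      by blast
    have mem: "ls ! r \<in> F" if "r < d" for r
      using that ls nth_mem[of r ls] by auto
    have "F \<noteq> {}"
      using mem[of 0] assms by auto
    then obtain v where "v \<in> F"
      by blast
    then have total: "(\<Sum>x<d. \<kappa> x) = B"
      using sum_count_set[of v "{..<d}"] F[of v] by simp
    have "set w \<subseteq> {..<d}"
      using mem F(1) sh_less by (fastforce simp: ls(2) \<Psi>_def)
    moreover have "count_list w j = B" if j: "j < d" for j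
    proof -
      have "count_list (concat (map f [0..<e])) j = (\<Sum>r<e. count_list (f r) j)"
        for f :: "nat \<Rightarrow> nat list" and e
        by (induction e) auto
      then have "count_list w j = (\<Sum>r<d. count_list (map (sh r) (ls ! r)) j)"
        by (simp add: ls(2) \<Psi>_def)
      \<comment> \<open>Block \<open>r\<close> contributes as many letters \<open>j\<close> as its
        unshifted word has letters \<open>un j r\<close>; over all \<open>r\<close> every letter is
        met once.\<close>
      also have "\<dots> = (\<Sum>r<d. \<kappa> (un j r))"
      proof (rule sum.cong[OF refl])
        fix r assume "r \<in> {..<d}"
        then have r: "r < d"
          by simp
        have "count_list (map (sh r) (ls ! r)) (sh r (un j r)) = count_list (ls ! r) (un j r)"
          using sh_inj[OF r] F(1)[OF mem[OF r]] un_less[OF r j] by (intro count_list_map_inj) auto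
        then show "count_list (map (sh r) (ls ! r)) j = \<kappa> (un j r)"
          using sh_un[OF r j] F(3)[OF mem[OF r] un_less[OF r j]] by simp
      qed
      also have "\<dots> = (\<Sum>x<d. \<kappa> x)"
        by (rule sum.reindex_bij_witness[of _ "un j" "un j"]) (use un_un un_less j in auto)
      finally show ?thesis
        using total by simp
    qed
    ultimately show "w \<in> balanced_words d B"
      by (simp add: balanced_words_def)
  qed
  ultimately have "card ?L \<le> card (balanced_words d B)"
    by (rule card_inj_on_le[OF _ _ finite_balanced_words])
  moreover have "finite F"
    by (rule finite_subset[OF _ finW]) (auto simp: F_def)
  ultimately have "card F ^ d \<le> card (balanced_words d B)"
    by (simp add: card_lists_length_eq)
  moreover have "d ^ (d * B) \<le> ((B + 1) ^ d * card F) ^ d"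
    using power_mono[OF pigeon, of d] by (simp add: power_mult[symmetric] mult.commute)
  ultimately show ?thesis
    by (smt (verit, best) mult.commute mult_le_mono1 order_trans power_mult power_mult_distrib)
qed

subsection \<open>Growth rates\<close>

text \<open>The factor 2 in the exponent comes from using pairs of ballot words; monotonicity in the
  size fills the gap up to \<open>n\<close>.\<close>

lemma card_Av_ge_power:
  assumes "1 \<le> d" "d * ((T + (d - 1)) * B) \<le> n"
  shows "card (balanced_words d B) ^ (2 * T) \<le> card (Av (Suc d) (decreasing_perm (Suc d)) n)"
proof -
  let ?C = "Av (Suc d) (decreasing_perm (Suc d))"
  have "card (balanced_words d B) ^ (2 * T) = (card (balanced_words d B) ^ T)\<^sup>2"
    by (simp add: power_mult[symmetric] mult.commute)
  also have "\<dots> \<le> (card {w \<in> balanced_words d ((T + (d - 1)) * B). ballot d w})\<^sup>2"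
    by (intro power_mono card_balanced_power_le) simp
  also have "\<dots> \<le> card (?C (d * ((T + (d - 1)) * B)))"
    by (rule card_ballot_words_le)
  also have "\<dots> \<le> card (?C n)"
    using lift_Suc_mono_le[of ?C, OF Av_decreasing_mono[OF assms(1)] assms(2)]
    by (rule card_mono[OF finite_Av])
  finally show ?thesis .
qed

text \<open>One more block in each word of a pair enlarges the permutation by \<open>d * B\<close>
  and squares the block count into the bound, so the right-hand side is the growth rate per unit of
  size obtained from blocks with parameter \<open>B\<close>.\<close>

lemma balanced_words_powr_ge:
  assumes "1 \<le> d" "1 \<le> B"
  shows "real d ^ 2 / (real B + 1) powr (2 * real d / real B)
    \<le> real (card (balanced_words d B)) powr (2 / (real d * real B))"
proof -
  let ?N = "real (card (balanced_words d B))" and ?e = "2 / (real d * real B)"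
  have "real (d ^ (d * B)) \<le> real (card (balanced_words d B) * (B + 1) ^ (d * d))"
    using card_balanced_words_ge[OF assms(1)] of_nat_mono by blast
  then have "real d ^ (d * B) / (real B + 1) ^ (d * d) \<le> ?N"
    by (simp add: divide_le_eq add.commute)
  then have "(real d ^ (d * B) / (real B + 1) ^ (d * d)) powr ?e \<le> ?N powr ?e"
    using assms by (intro powr_mono2) auto
  moreover have "(real d ^ (d * B) / (real B + 1) ^ (d * d)) powr ?e
      = (real d powr (real d * real B)) powr ?e / ((real B + 1) powr (real d * real d)) powr ?e"
    using assms by (simp add: powr_divide powr_realpow[symmetric])
  moreover have "(real d powr (real d * real B)) powr ?e = real d ^ 2"
    using assms by (simp add: powr_powr)
  moreover have "((real B + 1) powr (real d * real d)) powr ?e = (real B + 1) powr (2 * real d / real B)"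
    using assms by (simp add: powr_powr mult.commute)
  ultimately show ?thesis
    by simp
qed

lemma eventually_root_card_Av_gt:
  assumes "1 \<le> d" "y < (real d)\<^sup>2"
  shows "\<forall>\<^sub>F n in sequentially. y < root n (real (card (Av (Suc d) (decreasing_perm (Suc d)) n)))"
proof -
  define D where "D = real d"
  have D: "D > 0"
    using assms by (simp add: D_def)
  \<comment> \<open>The polynomial loss disappears in the limit; \<open>B\<close> is fixed first so
    that its rate beats \<open>y\<close>, and only then does \<open>n\<close> grow.\<close>
  have "(\<lambda>B::nat. D ^ 2 / (real B + 1) powr (2 * D / real B)) \<longlonglongrightarrow> D ^ 2"
    using D by real_asymp
  then have "\<forall>\<^sub>F B in sequentially. y < D ^ 2 / (real B + 1) powr (2 * D / real B)"
    using assms(2) by (intro order_tendstoD(1)) (auto simp: D_def)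
  then have "\<forall>\<^sub>F B in sequentially. 1 \<le> B \<and> y < D ^ 2 / (real B + 1) powr (2 * D / real B)"
    using eventually_ge_at_top[of "1::nat"] by eventually_elim auto
  then obtain B where B: "1 \<le> B" "y < D ^ 2 / (real B + 1) powr (2 * D / real B)"
    using eventually_happens'[OF sequentially_bot] by blast
  define N where "N = real (card (balanced_words d B))"
  have y: "y < N powr (2 / (D * real B))"
    using balanced_words_powr_ge[OF assms(1) B(1)] B(2) by (simp add: N_def D_def)
  have "0 < card (balanced_words d B)"
    using card_balanced_words_ge[OF assms(1), of B] assms(1) by (cases "card (balanced_words d B)") auto
  then have N: "1 \<le> N"
    by (simp add: N_def)
  \<comment> \<open>The correction \<open>2 * D / real n\<close> pays for the \<open>d - 1\<close>
    block lengths spent on prefix and suffix and for less than one lost in rounding \<open>n\<close>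
    down to a multiple of \<open>d * B\<close>.\<close>
  have "(\<lambda>n. N powr (2 / (D * real B) - 2 * D / real n)) \<longlonglongrightarrow> N powr (2 / (D * real B) - 0)"
    using N by (intro tendsto_powr tendsto_const tendsto_diff lim_const_over_n) auto
  then have "\<forall>\<^sub>F n in sequentially. y < N powr (2 / (D * real B) - 2 * D / real n)"
    using y by (intro order_tendstoD(1)) auto
  moreover have "\<forall>\<^sub>F n in sequentially. max 1 (d * d * B) \<le> n"
    by (rule eventually_ge_at_top)
  ultimately show ?thesis
  proof eventually_elim
    case (elim n)
    define q where "q = n div (d * B)"
    have dB: "0 < d * B"
      using assms(1) B(1) by simp
    have q: "d \<le> q"
      using elim(2) dB by (simp add: q_def less_eq_div_iff_mult_less_eq mult.assoc)
    define T where "T = q - (d - 1)"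
    have "d * ((T + (d - 1)) * B) \<le> n"
      using q div_times_less_eq_dividend[of n "d * B"] by (simp add: T_def q_def mult_ac)
    then have "card (balanced_words d B) ^ (2 * T) \<le> card (Av (Suc d) (decreasing_perm (Suc d)) n)"
      by (rule card_Av_ge_power[OF assms(1)])
    then have "real (card (balanced_words d B) ^ (2 * T)) \<le> real (card (Av (Suc d) (decreasing_perm (Suc d)) n))"
      by (rule of_nat_mono)
    then have le: "N powr (2 * real T) \<le> real (card (Av (Suc d) (decreasing_perm (Suc d)) n))"
      using N powr_realpow[of N "2 * T"] by (simp add: N_def)
    have n: "0 < n"
      using elim(2) by simp
    have "real n / (D * real B) < real q + 1"
    proof -
      have "n < (q + 1) * (d * B)"
        using dividend_less_div_times[OF dB, of n] by (simp add: q_def)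
      then have "real n < (real q + 1) * (D * real B)"
        unfolding D_def by (metis of_nat_1 of_nat_add of_nat_less_iff of_nat_mult)
      moreover have "0 < D * real B"
        using D B(1) by simp
      ultimately show ?thesis
        by (simp only: pos_divide_less_eq)
    qed
    then have "real n / (D * real B) - D \<le> real T"
      using q assms(1) by (simp add: T_def D_def of_nat_diff)
    moreover have "(2 / (D * real B) - 2 * D / real n) * real n = 2 * (real n / (D * real B) - D)"
      using n by (simp add: left_diff_distrib right_diff_distrib)
    ultimately have "(2 / (D * real B) - 2 * D / real n) * real n \<le> 2 * real T"
      by simp
    then have "2 / (D * real B) - 2 * D / real n \<le> 2 * real T / real n"
      using n by (simp add: pos_le_divide_eq)
    then have "N powr (2 / (D * real B) - 2 * D / real n) \<le> N powr (2 * real T / real n)"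
      by (rule powr_mono[OF _ N])
    also have "\<dots> = root n (N powr (2 * real T))"
      using n N by (simp add: root_powr_inverse powr_powr)
    also have "\<dots> \<le> root n (real (card (Av (Suc d) (decreasing_perm (Suc d)) n)))"
      using n le by simp
    finally show ?case
      using elim(1) by simp
  qed
qed

theorem theorem2p5:
  fixes k :: nat and C :: "nat \<Rightarrow> (nat \<Rightarrow> nat) set"
  assumes "k \<ge> 1"
  defines "C \<equiv> Av k (decreasing_perm k)"
  shows "\<exists>L::real.
           (\<lambda>n. root n (real (card (rc_slice C (2 * n))))) \<longlonglongrightarrow> L \<and>
           (\<lambda>n. root n (real (card (C n)))) \<longlonglongrightarrow> L"
proof -
  obtain d where d: "k = Suc d"
    using assms(1) by (cases k) auto
  let ?r = "\<lambda>n. root n (real (card (rc_slice C (2 * n))))"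
  let ?c = "\<lambda>n. root n (real (card (C n)))"
  have upper: "?r n \<le> (real d)\<^sup>2" if "0 < n" for n
  proof -
    have "real (card (rc_slice C (2 * n))) \<le> real (d ^ (2 * n))"
      unfolding C_def d by (intro of_nat_mono card_rc_slice_le)
    also have "\<dots> = ((real d)\<^sup>2) ^ n"
      by (simp add: power_mult)
    finally have "?r n \<le> root n (((real d)\<^sup>2) ^ n)"
      using that by simp
    then show ?thesis
      using that by (simp add: real_root_power_cancel)
  qed
  \<comment> \<open>At \<open>n = 0\<close> both sides vanish by the convention that
    \<open>root 0\<close> is 0.\<close>
  have mid: "?c n \<le> ?r n" for n
    using card_Av_le_card_rc_slice[of d n] by (cases "n = 0") (simp_all add: C_def d)
  have "?c \<longlonglongrightarrow> (real d)\<^sup>2"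
  proof (rule order_tendstoI)
    fix y assume y: "y < (real d)\<^sup>2"
    show "\<forall>\<^sub>F n in sequentially. y < ?c n"
    \<comment> \<open>The growth lemma needs a nonempty alphabet. For \<open>d = 0\<close> the limit
      is 0, so \<open>y\<close> is negative and nonnegativity of the root suffices.\<close>
    proof (cases "d = 0")
      case True
      have "y < ?c n" for n
        using y True real_root_ge_zero[of "real (card (C n))" n] by (simp add: order_less_le_trans)
      then show ?thesis
        by simp
    next
      case False
      then show ?thesis
        using eventually_root_card_Av_gt[of d y] y by (simp add: C_def d)
    qed
  next
    fix y assume y: "(real d)\<^sup>2 < y"
    show "\<forall>\<^sub>F n in sequentially. ?c n < y"
      using eventually_gt_at_top[of "0::nat"]
    proof eventually_elim
      case (elim n)
      then show ?case
        using upper[of n] mid[of n] y by linarith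
    qed
  qed
  moreover have "?r \<longlonglongrightarrow> (real d)\<^sup>2"
  proof (rule tendsto_sandwich[OF _ _ calculation tendsto_const])
    show "\<forall>\<^sub>F n in sequentially. ?r n \<le> (real d)\<^sup>2"
      using eventually_gt_at_top[of "0::nat"] by eventually_elim (rule upper)
  qed (use mid in auto)
  ultimately show ?thesis
    by blast
qed

end
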